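(* Let $|G\rangle$ be the weighted graph state of a weighted graph $G=(V,E,\Theta)$ on $n$ vertices, let $\mathscr{A}=\{A_1,\dots,A_m\}$ be an independence cover of $V$, let $N\ge 1$ be an integer and $\beta\in(0,1]$. Let $\Omega(\mathscr{A})=\frac1m\sum_{l=1}^m P_l$ be the test operator defined in the context. Then: (1) the state $|G\rangle^{\otimes (N+1)}$ passes the $N$-random sampling test of $\Omega(\mathscr{A})$ with probability $1$; (2) when the $N$-random sampling test of $\Omega(\mathscr{A})$ is passed, the resultant state $\sigma$ satisfies, with significance level $\beta$, $$\langle G|\sigma|G\rangle\ \ge\ 1-\frac{m(1-\beta)}{N\beta}.$$
   Context: **Weighted graph states.** A weighted graph $G=(V,E,\Theta)$ consists of a finite vertex set $V=[n]=\{1,\dots,n\}$, a set $E$ of edges, and real weights $\Theta=\{\theta_{jk}\}_{j<k}$, with $\theta_{jk}=0$ if $(j,k)\notin E$; put $\theta_{kj}=\theta_{jk}$. One qubit $\mathbb{C}^2$ is placed on each vertex. With $|+\rangle=(|0\rangle+|1\rangle)/\sqrt2$ and $\Lambda_{jk}(\theta)=|0\rangle\langle 0|_j\otimes I_k+|1\rangle\langle 1|_j\otimes(|0\rangle\langle 0|_k+e^{i\theta}|1\rangle\langle1|_k)$, the weighted graph state is $|G\rangle=\big[\prod_{(j,k)\in E}\Lambda_{jk}(\theta_{jk})\big]|+\rangle^{\otimes n}$. **Independence cover.** A subset of $V$ is independent if no two of its vertices are joined by an edge. An independence cover $\mathscr{A}=\{A_1,\dots,A_m\}$ is a set of independent sets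 with $\bigcup_l A_l=V$; throughout, the $A_l$ are nonempty and pairwise disjoint. $A_l^c=V\setminus A_l$. **Test operator.** For real $\alpha$ put $|\alpha\rangle=\frac1{\sqrt2}(|0\rangle+e^{i\alpha}|1\rangle)$. For $k\in A_l$, let $C_k\subset A_l^c$ be the set of neighbours of $k$, and for $\mathbf z=(z_j)_{j\in A_l^c}\in\{0,1\}^{A_l^c}$ put $\alpha_k(\mathbf z)=\sum_{j\in C_k}\theta_{jk}z_j$. Define $$Q_k=\sum_{\mathbf z\in\{0,1\}^{A_l^c}}|\alpha_k(\mathbf z)\rangle\langle\alpha_k(\mathbf z)|_k\otimes|\mathbf z\rangle\langle\mathbf z|_{A_l^c}$$ (acting as the identity on $A_l\setminus\{k\}$), $P_l=\prod_{k\in A_l}Q_k$, and $\Omega(\mathscr{A})=\frac1m\sum_{l=1}^mP_l$. **$N$-random sampling test of an operator $0\le\Omega\le I$.** Let $\rho$ be an arbitrary state (no i.i.d. assumption) on $N+1$ copies of the $n$-qubit system. Choose $N$ of the $N+1$ copies uniformly at random, apply the two-outcome POVM $\{\Omega,I-\Omega\}$ to each of them, and accept (the test is passed) iff all $N$ outcomes correspond to $\Omega$. When the test is passed, the resultant state $\sigma$ is the state of the remaining copy conditional on acceptance. Explicitly, writing $\Omega^{(i)}$ for the operator acting as $\Omega$ on every copy except the $i$-th and as $I$ on the $i$-th, the passing probability is $p(\rho)=\frac1{N+1}\sum_{i=1}^{N+1}\mathrm{Tr}[\Omega^{(i)}\rho]$, and $\mathrm{Tr}[\sigma X]=\frac{1}{p(\rho)(N+1)}\sum_{i=1}^{N+1}\mathrm{Tr}[\Omega^{(i)}X_i\,\rho]$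 for every operator $X$ on a single copy, where $X_i$ is $X$ acting on the $i$-th copy. **Significance level.** A statement about $\sigma$ holds "with significance level $\beta$" if it holds for every $\rho$ with passing probability $p(\rho)\ge\beta$. *)

theory Defs
  imports "HOL-Analysis.Analysis" "HOL-Library.Disjoint_Sets"
begin

text \<open>
  Operators on a finite-dimensional space with orthonormal basis indexed by \<open>'i\<close> are matrices.
  A tensor product over a finite index type \<open>'t\<close> of spaces with basis type \<open>'a\<close> has basis type
  \<open>'t \<Rightarrow> 'a\<close>. Hence a qubit has basis type \<open>bool\<close> (\<open>False\<close> for 0 and \<open>True\<close> for 1), qubits on the
  vertices \<open>'v\<close> have basis type \<open>'v \<Rightarrow> bool\<close>, and copies of these labelled by \<open>'c\<close> have
  basis type \<open>'c \<Rightarrow> 'v \<Rightarrow> bool\<close>. Matrix multiplication is \<open>**\<close>, not the componentwise \<open>*\<close>.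
  The order on \<open>complex\<close> is such that \<open>x \<le> y\<close> iff \<open>Re x \<le> Re y\<close> and \<open>Im x = Im y\<close>.
\<close>

type_synonym 'i op = "complex^'i^'i"

definition ketbra :: "complex^'i \<Rightarrow> complex^'i \<Rightarrow> 'i::finite op" where
  "ketbra u v = (\<chi> x y. u $ x * cnj (v $ y))"

definition braket_op :: "complex^'i \<Rightarrow> 'i::finite op \<Rightarrow> complex^'i \<Rightarrow> complex" where
  "braket_op u A v = (\<Sum>x\<in>UNIV. cnj (u $ x) * (A *v v) $ x)"

definition quantum_state :: "'i::finite op \<Rightarrow> bool" where
  "quantum_state \<rho> \<longleftrightarrow> (\<forall>v. 0 \<le> braket_op v \<rho> v) \<and> trace \<rho> = 1"

definition tensor_vec :: "('t::finite \<Rightarrow> complex^'a) \<Rightarrow> complex^('t \<Rightarrow> 'a::finite)" where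
  "tensor_vec \<psi> = (\<chi> x. \<Prod>t\<in>UNIV. \<psi> t $ x t)"

definition tensor_op :: "('t::finite \<Rightarrow> 'a::finite op) \<Rightarrow> ('t \<Rightarrow> 'a) op" where
  "tensor_op A = (\<chi> x y. \<Prod>t\<in>UNIV. A t $ x t $ y t)"

definition on_site :: "'t::finite \<Rightarrow> 'a::finite op \<Rightarrow> ('t \<Rightarrow> 'a) op" where
  "on_site t A = tensor_op (\<lambda>s. if s = t then A else mat 1)"

definition op_prod :: "'i::finite op list \<Rightarrow> 'i op" where
  "op_prod As = foldr (**) As (mat 1)"

definition ket :: "bool \<Rightarrow> complex^bool" where
  "ket b = axis b 1"

definition plus_ket :: "complex^bool" where
  "plus_ket = (1 / sqrt 2) *\<^sub>R (ket False + ket True)"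

definition phase_ket :: "real \<Rightarrow> complex^bool" where
  "phase_ket \<alpha> = (1 / sqrt 2) *\<^sub>R (ket False + cis \<alpha> *s ket True)"

text \<open>An edge is stored once, as the pair \<open>(j, k)\<close> with \<open>j < k\<close>.\<close>

definition weighted_graph :: "('v::{finite,linorder} \<times> 'v) set \<Rightarrow> ('v \<Rightarrow> 'v \<Rightarrow> real) \<Rightarrow> bool" where
  "weighted_graph E \<theta> \<longleftrightarrow>
     (\<forall>(j, k) \<in> E. j < k) \<and>
     (\<forall>j k. j < k \<and> (j, k) \<notin> E \<longrightarrow> \<theta> j k = 0) \<and>
     (\<forall>j k. \<theta> k j = \<theta> j k)"

definition adjacent :: "('v \<times> 'v) set \<Rightarrow> 'v \<Rightarrow> 'v \<Rightarrow> bool" where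
  "adjacent E j k \<longleftrightarrow> (j, k) \<in> E \<or> (k, j) \<in> E"

definition controlled_phase :: "'v::finite \<Rightarrow> 'v \<Rightarrow> real \<Rightarrow> ('v \<Rightarrow> bool) op" where
  "controlled_phase j k \<theta> =
     on_site j (ketbra (ket False) (ket False)) +
     on_site j (ketbra (ket True) (ket True)) **
       on_site k (ketbra (ket False) (ket False) +
                  (\<chi> x y. cis \<theta> * ketbra (ket True) (ket True) $ x $ y))"

text \<open>
  The factors are diagonal and hence commute; the edges are listed lexicographically
  only to have a definite product.
\<close>

definition graph_state ::
  "('v::{finite,linorder} \<times> 'v) set \<Rightarrow> ('v \<Rightarrow> 'v \<Rightarrow> real) \<Rightarrow> complex^('v \<Rightarrow> bool)" where
  "graph_state E \<theta> =
     op_prod [controlled_phase j k (\<theta> j k).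
       j \<leftarrow> sorted_list_of_set UNIV, k \<leftarrow> sorted_list_of_set UNIV, (j, k) \<in> E]
     *v tensor_vec (\<lambda>_. plus_ket)"

definition independent_set :: "('v \<times> 'v) set \<Rightarrow> 'v set \<Rightarrow> bool" where
  "independent_set E A \<longleftrightarrow> (\<forall>j\<in>A. \<forall>k\<in>A. \<not> adjacent E j k)"

text \<open>The members of a cover are nonempty and pairwise disjoint.\<close>

definition independence_cover :: "('v \<times> 'v) set \<Rightarrow> 'v set set \<Rightarrow> bool" where
  "independence_cover E \<A> \<longleftrightarrow> partition_on UNIV \<A> \<and> (\<forall>A\<in>\<A>. independent_set E A)"

definition phase_angle ::
  "('v::finite \<times> 'v) set \<Rightarrow> ('v \<Rightarrow> 'v \<Rightarrow> real) \<Rightarrow> 'v \<Rightarrow> ('v \<Rightarrow> bool) \<Rightarrow> real" where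
  "phase_angle E \<theta> k z = (\<Sum>j | adjacent E j k. \<theta> j k * of_bool (z j))"

definition basis_projector :: "'v::finite set \<Rightarrow> ('v \<Rightarrow> bool) \<Rightarrow> ('v \<Rightarrow> bool) op" where
  "basis_projector B z = tensor_op (\<lambda>j. if j \<in> B then ketbra (ket (z j)) (ket (z j)) else mat 1)"

text \<open>A bit string on \<open>- A\<close> is an extensional function in \<open>PiE (- A) (\<lambda>_. UNIV)\<close>.\<close>

definition test_Q ::
  "('v::finite \<times> 'v) set \<Rightarrow> ('v \<Rightarrow> 'v \<Rightarrow> real) \<Rightarrow> 'v set \<Rightarrow> 'v \<Rightarrow> ('v \<Rightarrow> bool) op" where
  "test_Q E \<theta> A k =
     (\<Sum>z \<in> PiE (- A) (\<lambda>_. UNIV).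
        on_site k (ketbra (phase_ket (phase_angle E \<theta> k z)) (phase_ket (phase_angle E \<theta> k z))) **
        basis_projector (- A) z)"

text \<open>The factors commute when \<open>A\<close> is independent, so the order of the product is immaterial.\<close>

definition test_P ::
  "('v::{finite,linorder} \<times> 'v) set \<Rightarrow> ('v \<Rightarrow> 'v \<Rightarrow> real) \<Rightarrow> 'v set \<Rightarrow> ('v \<Rightarrow> bool) op" where
  "test_P E \<theta> A = op_prod (map (test_Q E \<theta> A) (sorted_list_of_set A))"

definition test_operator ::
  "('v::{finite,linorder} \<times> 'v) set \<Rightarrow> ('v \<Rightarrow> 'v \<Rightarrow> real) \<Rightarrow> 'v set set \<Rightarrow> ('v \<Rightarrow> bool) op" where
  "test_operator E \<theta> \<A> = (1 / real (card \<A>)) *\<^sub>R (\<Sum>A\<in>\<A>. test_P E \<theta> A)"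

text \<open>
  The copies are labelled by \<open>'c\<close>, so that \<open>CARD('c)\<close> is the number of sampled copies plus one.
\<close>

definition all_but :: "'c::finite \<Rightarrow> 'q::finite op \<Rightarrow> ('c \<Rightarrow> 'q) op" where
  "all_but i \<Omega> = tensor_op (\<lambda>j. if j = i then mat 1 else \<Omega>)"

definition pass_prob :: "'q::finite op \<Rightarrow> ('c::finite \<Rightarrow> 'q) op \<Rightarrow> complex" where
  "pass_prob \<Omega> \<rho> = 1 / of_nat CARD('c) * (\<Sum>i\<in>UNIV. trace (all_but i \<Omega> ** \<rho>))"

definition resultant_state :: "'q::finite op \<Rightarrow> ('c::finite \<Rightarrow> 'q) op \<Rightarrow> 'q op \<Rightarrow> bool" where
  "resultant_state \<Omega> \<rho> \<sigma> \<longleftrightarrow>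
     (\<forall>X. trace (\<sigma> ** X) =
        1 / (pass_prob \<Omega> \<rho> * of_nat CARD('c)) *
        (\<Sum>i\<in>UNIV. trace (all_but i \<Omega> ** on_site i X ** \<rho>)))"

lemma on_site_nth:
  "on_site i X $ x $ y = X $ x i $ y i * (\<Prod>t\<in>UNIV - {i}. mat 1 $ x t $ y t)"
proof -
  have "on_site i X $ x $ y = (\<Prod>t\<in>UNIV. (if t = i then X else mat 1) $ x t $ y t)"
    by (simp add: on_site_def tensor_op_def)
  also have "\<dots> = X $ x i $ y i * (\<Prod>t\<in>UNIV - {i}. (if t = i then X else mat 1) $ x t $ y t)"
    by (subst prod.remove[of _ i]) auto
  also have "(\<Prod>t\<in>UNIV - {i}. (if t = i then X else mat 1) $ x t $ y t) =
      (\<Prod>t\<in>UNIV - {i}. mat 1 $ x t $ y t)"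
    by (intro prod.cong) auto
  finally show ?thesis .
qed

lemma resultant_state_ex1:
  fixes \<Omega> :: "'q::finite op" and \<rho> :: "('c::finite \<Rightarrow> 'q) op"
  shows "\<exists>!\<sigma>. resultant_state \<Omega> \<rho> \<sigma>"
proof -
  define c where "c = 1 / (pass_prob \<Omega> \<rho> * of_nat CARD('c))"
  define L where
    "L X = c * (\<Sum>i\<in>UNIV. trace (all_but i \<Omega> ** on_site i X ** \<rho>))" for X :: "'q op"
  define K where "K i x y a b = c * (all_but i \<Omega> $ x $ a *
      (\<Prod>t\<in>UNIV - {i}. mat 1 $ a t $ b t) * \<rho> $ b $ y)" for i x y a b
  define U where "U u v = (\<chi> a b. if a = u \<and> b = v then 1 else (0 :: complex))" for u v :: 'q
  have L_eq: "L X = (\<Sum>i\<in>UNIV. \<Sum>x\<in>UNIV. \<Sum>b\<in>UNIV. \<Sum>a\<in>UNIV. K i x x a b * X $ a i $ b i)"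
    for X
    unfolding L_def K_def trace_def matrix_matrix_mult_def
    by (simp add: on_site_nth sum_distrib_left sum_distrib_right mult_ac)
  have X_eq: "X $ a $ b = (\<Sum>u\<in>UNIV. \<Sum>v\<in>UNIV. X $ u $ v * U u v $ a $ b)" for X :: "'q op" and a b
  proof -
    have "(\<Sum>u\<in>UNIV. \<Sum>v\<in>UNIV. X $ u $ v * U u v $ a $ b) =
        (\<Sum>u\<in>UNIV. \<Sum>v\<in>UNIV. if v = b then (if u = a then X $ u $ v else 0) else 0)"
      unfolding U_def by (intro sum.cong) auto
    then show ?thesis by simp
  qed
  have L_lin: "L X = (\<Sum>u\<in>UNIV. \<Sum>v\<in>UNIV. X $ u $ v * L (U u v))" for X
  proof -
    have "L X = (\<Sum>i\<in>UNIV. \<Sum>x\<in>UNIV. \<Sum>b\<in>UNIV. \<Sum>a\<in>UNIV. \<Sum>u\<in>UNIV. \<Sum>v\<in>UNIV.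
        X $ u $ v * (K i x x a b * U u v $ a i $ b i))"
      unfolding L_eq by (subst X_eq) (simp add: sum_distrib_left mult_ac)
    also have "\<dots> = (\<Sum>u\<in>UNIV. \<Sum>v\<in>UNIV. \<Sum>i\<in>UNIV. \<Sum>x\<in>UNIV. \<Sum>b\<in>UNIV. \<Sum>a\<in>UNIV.
        X $ u $ v * (K i x x a b * U u v $ a i $ b i))"
      by (simp only: sum.cartesian_product)
        (rule sum.reindex_bij_witness[where
          i = "\<lambda>(u,v,i,x,b,a). (i,x,b,a,u,v)" and j = "\<lambda>(i,x,b,a,u,v). (u,v,i,x,b,a)"]; auto)
    also have "\<dots> = (\<Sum>u\<in>UNIV. \<Sum>v\<in>UNIV. X $ u $ v * L (U u v))"
      unfolding L_eq by (simp add: sum_distrib_left)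
    finally show ?thesis .
  qed
  have tr: "trace (\<sigma> ** X) = (\<Sum>u\<in>UNIV. \<Sum>v\<in>UNIV. X $ u $ v * \<sigma> $ v $ u)" for \<sigma> X :: "'q op"
    unfolding trace_def matrix_matrix_mult_def by (subst sum.swap) (simp add: mult.commute)
  have trU: "trace (\<sigma> ** U u v) = \<sigma> $ v $ u" for \<sigma> :: "'q op" and u v
  proof -
    have "trace (\<sigma> ** U u v) =
        (\<Sum>a\<in>UNIV. \<Sum>b\<in>UNIV. if b = v then (if a = u then \<sigma> $ b $ a else 0) else 0)"
      unfolding tr U_def by (intro sum.cong) auto
    then show ?thesis by simp
  qed
  have iff: "resultant_state \<Omega> \<rho> \<sigma> \<longleftrightarrow> (\<forall>X. trace (\<sigma> ** X) = L X)" for \<sigma>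
    by (simp add: resultant_state_def L_def c_def)
  show ?thesis
  proof (rule ex1I)
    show "resultant_state \<Omega> \<rho> (\<chi> v u. L (U u v))"
      unfolding iff tr by (subst L_lin) simp
  next
    fix \<sigma> assume "resultant_state \<Omega> \<rho> \<sigma>"
    then have "\<sigma> $ v $ u = L (U u v)" for u v
      using trU unfolding iff by metis
    then show "\<sigma> = (\<chi> v u. L (U u v))"
      by (simp add: vec_eq_iff)
  qed
qed

end

theory Submission
  imports Defs
begin

text \<open>
  Let \<open>U\<close> be the diagonal unitary that prepares the graph state from \<open>|+\<dots>+\<rangle>\<close>. A flip of qubit \<open>k\<close>
  changes the phase of \<open>U\<close> by exactly the angle \<open>\<alpha>\<^sub>k\<close>, so \<open>Q\<^sub>k\<close> is the conjugate by \<open>U\<close> of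
  \<open>|+\<rangle>\<langle>+|\<close> on qubit \<open>k\<close>. Hence all \<open>P\<^sub>l\<close> are diagonal in the image under \<open>U\<close> of the Hadamard
  basis \<open>|s\<rangle>\<close>, and \<open>\<Omega>\<close> has there the eigenvalue \<open>#{l. s = 0 on A\<^sub>l} / m\<close>. It is 1 at the graph
  state \<open>s = 0\<close> and, as the \<open>A\<^sub>l\<close> cover \<open>V\<close>, at most \<open>\<mu> = 1 - 1/m\<close> elsewhere.

  Measuring all copies in this basis turns \<open>\<rho>\<close> into a probability distribution on tuples of basis
  labels. If \<open>k\<close> copies are bad (\<open>s \<noteq> 0\<close>), then \<open>k \<mu>\<^sup>k\<^sup>-\<^sup>1 (1 - \<mu>) + \<mu>\<^sup>k \<le> 1\<close> bounds the passing
  probabilities. Averaged over the distribution this reads \<open>N (1 - \<mu>) p (1 - F) + p \<le> 1\<close> for the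
  passing probability \<open>p\<close> and the fidelity \<open>F\<close>, which is the claim when \<open>p \<ge> \<beta>\<close>.
\<close>

subsection \<open>Operators diagonal in a given basis\<close>

text \<open>Distributivity: sums over configurations factor over the sites, which reduces identities
  between tensor products to single sites.\<close>

lemma sum_prod_fun:
  fixes f :: "'t::finite \<Rightarrow> 'a::finite \<Rightarrow> 'b::comm_semiring_1"
  shows "(\<Sum>z\<in>UNIV. \<Prod>t\<in>UNIV. f t (z t)) = (\<Prod>t\<in>UNIV. \<Sum>a\<in>UNIV. f t a)"
  by (subst prod_sum_PiE) auto

lemma tensor_op_mult:
  "tensor_op A ** tensor_op B = tensor_op (\<lambda>t. A t ** B t)"
  by (simp add: vec_eq_iff tensor_op_def matrix_matrix_mult_def flip: prod.distrib sum_prod_fun)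

lemma trace_ketbra_mult: "trace (ketbra u v ** M) = braket_op v M u"
proof -
  have "trace (ketbra u v ** M) = (\<Sum>x\<in>UNIV. \<Sum>y\<in>UNIV. u $ x * cnj (v $ y) * M $ y $ x)"
    by (simp add: trace_def ketbra_def matrix_matrix_mult_def)
  also have "\<dots> = (\<Sum>y\<in>UNIV. \<Sum>x\<in>UNIV. u $ x * cnj (v $ y) * M $ y $ x)"
    by (rule sum.swap)
  also have "\<dots> = braket_op v M u"
    by (simp add: braket_op_def matrix_vector_mult_def sum_distrib_left mult_ac)
  finally show ?thesis .
qed

lemma braket_ketbra:
  "braket_op v (ketbra u u) v = (\<Sum>x\<in>UNIV. cnj (v $ x) * u $ x) * cnj (\<Sum>x\<in>UNIV. cnj (v $ x) * u $ x)"
proof -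
  have "(ketbra u u *v v) $ x = u $ x * cnj (\<Sum>x\<in>UNIV. cnj (v $ x) * u $ x)" for x
    by (simp add: ketbra_def matrix_vector_mult_def sum_distrib_left mult_ac)
  then show ?thesis
    by (simp add: braket_op_def sum_distrib_right mult.assoc)
qed

lemma braket_ketbra_nonneg: "0 \<le> braket_op v (ketbra u u) v"
  unfolding braket_ketbra complex_norm_square[symmetric] by (simp add: less_eq_complex_def)

lemma trace_ketbra: "trace (ketbra u u) = (\<Sum>x\<in>UNIV. cnj (u $ x) * u $ x)"
  by (simp add: trace_def ketbra_def mult.commute)

lemma quantum_state_ketbra:
  assumes "(\<Sum>x\<in>UNIV. cnj (u $ x) * u $ x) = 1"
  shows "quantum_state (ketbra u u)"
  using assms by (simp add: quantum_state_def braket_ketbra_nonneg trace_ketbra)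

lemma tensor_vec_inner:
  "(\<Sum>x\<in>UNIV. cnj (tensor_vec u $ x) * tensor_vec v $ x) =
     (\<Prod>t\<in>UNIV. \<Sum>a\<in>UNIV. cnj (u t $ a) * v t $ a)"
  by (simp add: tensor_vec_def flip: prod.distrib sum_prod_fun)

text \<open>For orthonormal \<open>g\<close> this is a spectral decomposition with eigenvectors
  \<open>g s\<close> and eigenvalues \<open>c s\<close>; orthonormality is left to the lemmas that
  use it.\<close>

definition spectral_op :: "('k::finite \<Rightarrow> complex^'q) \<Rightarrow> ('k \<Rightarrow> real) \<Rightarrow> 'q::finite op" where
  "spectral_op g c = (\<chi> x y. \<Sum>s\<in>UNIV. of_real (c s) * (g s $ x * cnj (g s $ y)))"

lemma spectral_op_nth:
  "spectral_op g c $ x $ y = (\<Sum>s\<in>UNIV. of_real (c s) * (g s $ x * cnj (g s $ y)))"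
  by (simp add: spectral_op_def)

lemma spectral_op_sum: "(\<Sum>a\<in>A. spectral_op g (c a)) = spectral_op g (\<lambda>s. \<Sum>a\<in>A. c a s)"
  by (simp add: vec_eq_iff spectral_op_nth sum_distrib_right) (intro allI sum.swap)

lemma spectral_op_scaleR: "r *\<^sub>R spectral_op g c = spectral_op g (\<lambda>s. r * c s)"
  by (simp add: vec_eq_iff spectral_op_nth scaleR_sum_right) (simp add: scaleR_conv_of_real mult_ac)

lemma spectral_op_indicator: "spectral_op g (\<lambda>s. of_bool (s = a)) = ketbra (g a) (g a)"
  by (simp add: vec_eq_iff spectral_op_nth ketbra_def of_bool_def if_distrib[of complex_of_real]
      if_distrib[of "\<lambda>x. x * _"] cong: if_cong)

lemma trace_spectral_op_mult:
  fixes g :: "'k::finite \<Rightarrow> complex^'q::finite"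
  shows "trace (spectral_op g c ** M) = (\<Sum>s\<in>UNIV. of_real (c s) * braket_op (g s) M (g s))"
proof -
  have "trace (spectral_op g c ** M) = (\<Sum>x\<in>UNIV. \<Sum>y\<in>UNIV. \<Sum>s\<in>UNIV.
      of_real (c s) * (g s $ x * cnj (g s $ y)) * M $ y $ x)"
    by (simp add: trace_def spectral_op_nth matrix_matrix_mult_def sum_distrib_right)
  also have "\<dots> = (\<Sum>x\<in>UNIV. \<Sum>s\<in>UNIV. \<Sum>y\<in>UNIV.
      of_real (c s) * (g s $ x * cnj (g s $ y)) * M $ y $ x)"
    by (intro sum.cong refl sum.swap)
  also have "\<dots> = (\<Sum>s\<in>UNIV. \<Sum>x\<in>UNIV. \<Sum>y\<in>UNIV.
      of_real (c s) * (g s $ x * cnj (g s $ y)) * M $ y $ x)"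
    by (rule sum.swap)
  also have "\<dots> = (\<Sum>s\<in>UNIV. of_real (c s) * trace (ketbra (g s) (g s) ** M))"
    by (simp add: trace_def ketbra_def matrix_matrix_mult_def sum_distrib_left mult_ac)
  finally show ?thesis
    by (simp add: trace_ketbra_mult)
qed

text \<open>Expanding the product of sums gives one term per tuple of labels, so product operators
  are diagonal in the product basis and their eigenvalues multiply.\<close>

lemma tensor_op_spectral_op:
  fixes c :: "'t::finite \<Rightarrow> 'k::finite \<Rightarrow> real"
  shows "tensor_op (\<lambda>t. spectral_op g (c t)) =
    spectral_op (\<lambda>S. tensor_vec (\<lambda>t. g (S t))) (\<lambda>S. \<Prod>t\<in>UNIV. c t (S t))"
  by (simp add: vec_eq_iff tensor_op_def spectral_op_nth tensor_vec_def
      flip: prod.distrib sum_prod_fun)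

lemma spectral_op_mult:
  fixes g :: "'k::finite \<Rightarrow> complex^'q::finite"
  assumes orth: "\<And>s t. (\<Sum>x\<in>UNIV. cnj (g s $ x) * g t $ x) = of_bool (s = t)"
  shows "spectral_op g c ** spectral_op g d = spectral_op g (\<lambda>s. c s * d s)"
proof -
  have "(spectral_op g c ** spectral_op g d) $ x $ y = spectral_op g (\<lambda>s. c s * d s) $ x $ y" for x y
  proof -
    have "(spectral_op g c ** spectral_op g d) $ x $ y =
      (\<Sum>z\<in>UNIV. \<Sum>s\<in>UNIV. \<Sum>t\<in>UNIV. of_real (c s) * of_real (d t) *
         (g s $ x * cnj (g t $ y)) * (cnj (g s $ z) * g t $ z))"
      by (simp add: matrix_matrix_mult_def spectral_op_nth sum_product mult_ac)
    also have "\<dots> = (\<Sum>s\<in>UNIV. \<Sum>z\<in>UNIV. \<Sum>t\<in>UNIV. of_real (c s) * of_real (d t) *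
         (g s $ x * cnj (g t $ y)) * (cnj (g s $ z) * g t $ z))"
      by (rule sum.swap)
    also have "\<dots> = (\<Sum>s\<in>UNIV. \<Sum>t\<in>UNIV. \<Sum>z\<in>UNIV. of_real (c s) * of_real (d t) *
         (g s $ x * cnj (g t $ y)) * (cnj (g s $ z) * g t $ z))"
      by (intro sum.cong refl sum.swap)
    also have "\<dots> = (\<Sum>s\<in>UNIV. \<Sum>t\<in>UNIV. of_real (c s) * of_real (d t) *
         (g s $ x * cnj (g t $ y)) * of_bool (s = t))"
      by (simp add: orth flip: sum_distrib_left)
    also have "\<dots> = (\<Sum>s\<in>UNIV. of_real (c s) * of_real (d s) * (g s $ x * cnj (g s $ y)))"
      by (simp add: of_bool_def if_distrib cong: if_cong)
    finally show ?thesis by (simp add: spectral_op_nth)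
  qed
  then show ?thesis by (simp add: vec_eq_iff)
qed

subsection \<open>The sampling test\<close>

text \<open>The left side is the probability of at most one failure in \<open>k\<close> independent
  trials with success probability \<mu>. For \<open>k = 0\<close> the truncated exponent is
  harmless, its term being 0.\<close>

lemma power_pred_mult_le:
  fixes \<mu> :: real
  assumes "0 \<le> \<mu>" "\<mu> \<le> 1"
  shows "real k * \<mu> ^ (k - 1) * (1 - \<mu>) + \<mu> ^ k \<le> 1"
proof (induction k)
  case (Suc k)
  \<comment> \<open>Expanded, the value at \<open>Suc k\<close> is
    \<open>real k * \<mu> ^ k * (1 - \<mu>) + \<mu> ^ k\<close>, so only one exponent has to be
    lowered.\<close>
  have "real k * \<mu> ^ k * (1 - \<mu>) \<le> real k * \<mu> ^ (k - 1) * (1 - \<mu>)"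
    using assms by (intro mult_right_mono mult_left_mono power_decreasing) auto
  with Suc show ?case by (simp add: algebra_simps)
qed simp

text \<open>\<open>B\<close> is the set of bad copies, \<open>k\<close> its size. Leaving out a bad
  copy leaves \<open>k - 1\<close> factors that are at most \<mu>, leaving out a good one leaves
  \<open>k\<close>; the resulting bound is N + 1 times the expression of
  \<open>power_pred_mult_le\<close>.\<close>

lemma sum_prod_all_but_le:
  fixes l :: "'c::finite \<Rightarrow> real"
  assumes N: "CARD('c) = N + 1" and \<mu>: "0 \<le> \<mu>" "\<mu> \<le> 1"
    and good: "\<And>i. i \<notin> B \<Longrightarrow> l i = 1" and bad: "\<And>i. i \<in> B \<Longrightarrow> 0 \<le> l i \<and> l i \<le> \<mu>"
  shows "real N * (1 - \<mu>) * (\<Sum>i\<in>B. \<Prod>j\<in>-{i}. l j) + (\<Sum>i\<in>UNIV. \<Prod>j\<in>-{i}. l j) \<le> real N + 1"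
proof (cases "B = {}")
  case True
  then show ?thesis using good N by simp
next
  case False
  define k where "k = card B"
  have k: "k > 0" using False by (simp add: k_def card_gt_0_iff)
  have k_le: "k \<le> N + 1" unfolding k_def N[symmetric] by (rule card_mono) auto
  have le: "(\<Prod>j\<in>-{i}. l j) \<le> \<mu> ^ card (B - {i})" for i
  proof -
    have "(\<Prod>j\<in>-{i}. l j) = (\<Prod>j\<in>B - {i}. l j)"
      by (rule prod.mono_neutral_right) (use good in auto)
    also have "\<dots> \<le> (\<Prod>j\<in>B - {i}. \<mu>)"
      using bad by (intro prod_mono) auto
    finally show ?thesis by simp
  qed
  have B: "(\<Sum>i\<in>B. \<Prod>j\<in>-{i}. l j) \<le> real k * \<mu> ^ (k - 1)"
    unfolding k_def by (rule sum_bounded_above) (use le in \<open>metis card_Diff_singleton\<close>)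
  have "card (- B) = N + 1 - k"
    by (simp add: Compl_eq_Diff_UNIV card_Diff_subset N k_def)
  then have G: "(\<Sum>i\<in>-B. \<Prod>j\<in>-{i}. l j) \<le> (real N + 1 - real k) * \<mu> ^ k"
    using sum_bounded_above[of "-B" "\<lambda>i. \<Prod>j\<in>-{i}. l j" "\<mu> ^ k"] le[folded k_def] le k_def k_le
    by (metis (no_types, lifting) ComplD Diff_insert0 Diff_empty of_nat_Suc Suc_eq_plus1 of_nat_diff add.commute)
  have "(\<Sum>i\<in>UNIV. \<Prod>j\<in>-{i}. l j) = (\<Sum>i\<in>B. \<Prod>j\<in>-{i}. l j) + (\<Sum>i\<in>-B. \<Prod>j\<in>-{i}. l j)"
    by (metis Compl_partition2 add.commute finite_code sum.Int_Diff sum.union_disjoint Compl_disjoint2)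
  then have "real N * (1 - \<mu>) * (\<Sum>i\<in>B. \<Prod>j\<in>-{i}. l j) + (\<Sum>i\<in>UNIV. \<Prod>j\<in>-{i}. l j)
      = (real N * (1 - \<mu>) + 1) * (\<Sum>i\<in>B. \<Prod>j\<in>-{i}. l j) + (\<Sum>i\<in>-B. \<Prod>j\<in>-{i}. l j)"
    by (simp add: algebra_simps)
  also have "\<dots> \<le> (real N * (1 - \<mu>) + 1) * (real k * \<mu> ^ (k - 1)) + (real N + 1 - real k) * \<mu> ^ k"
    using \<mu> by (intro add_mono mult_left_mono B G) auto
  also have "\<dots> = (real N + 1) * (real k * \<mu> ^ (k - 1) * (1 - \<mu>) + \<mu> ^ k)"
    using k by (cases k) (simp_all add: algebra_simps)
  also have "\<dots> \<le> (real N + 1) * 1"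
    by (intro mult_left_mono power_pred_mult_le \<mu>) auto
  finally show ?thesis by simp
qed

section \<open>Passing probability and fidelity for an operator with a spectral gap\<close>

text \<open>All that the sampling argument needs of the graph: a test operator diagonal in an
  orthonormal basis, with eigenvalue 1 at the target label \<open>a\<close> and a gap of at least 1
  - \<mu> below it.\<close>

locale spectral_test =
  fixes g :: "'k::finite \<Rightarrow> complex^'q::finite" and \<Omega> :: "'q op" and c :: "'k \<Rightarrow> real" and a :: 'k
    and \<mu> :: real
  assumes complete: "spectral_op g (\<lambda>_. 1) = mat 1"
    and orth: "\<And>s t. (\<Sum>x\<in>UNIV. cnj (g s $ x) * g t $ x) = of_bool (s = t)"
    and \<Omega>: "\<Omega> = spectral_op g c"
    and ca: "c a = 1"
    and gap: "\<And>s. s \<noteq> a \<Longrightarrow> 0 \<le> c s \<and> c s \<le> \<mu>"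
    and \<mu>: "0 \<le> \<mu>" "\<mu> < 1"
begin

text \<open>The probability of the labels \<open>S\<close> when every copy is measured in the basis
  \<open>g\<close>; for a state, \<open>Re\<close> only changes the type.\<close>

definition outcome :: "('c::finite \<Rightarrow> 'q) op \<Rightarrow> ('c \<Rightarrow> 'k) \<Rightarrow> real" where
  "outcome \<rho> S = Re (braket_op (tensor_vec (\<lambda>t. g (S t))) \<rho> (tensor_vec (\<lambda>t. g (S t))))"

context
  fixes \<rho> :: "('c::finite \<Rightarrow> 'q) op"
  assumes state: "quantum_state \<rho>"
begin

lemma outcome_nonneg: "0 \<le> outcome \<rho> S"
  using state by (simp add: quantum_state_def outcome_def less_eq_complex_def)

text \<open>Product operators diagonal in the measured basis see only the diagonal of \<rho>, so
  their expectations are classical averages. Correlations between copies need no separate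
  treatment.\<close>

lemma trace_tensor_spectral_op:
  "trace (tensor_op (\<lambda>t. spectral_op g (d t)) ** \<rho>) =
     of_real (\<Sum>S\<in>UNIV. outcome \<rho> S * (\<Prod>t\<in>UNIV. d t (S t)))"
proof -
  have "braket_op (tensor_vec (\<lambda>t. g (S t))) \<rho> (tensor_vec (\<lambda>t. g (S t))) = of_real (outcome \<rho> S)" for S
    using state by (simp add: quantum_state_def outcome_def less_eq_complex_def complex_eq_iff)
  then show ?thesis
    unfolding tensor_op_spectral_op trace_spectral_op_mult
    by (simp add: mult.commute)
qed

text \<open>By completeness, constant eigenvalue 1 turns the product operator into the identity, and
  \<rho> has trace 1.\<close>

lemma sum_outcome: "(\<Sum>S\<in>UNIV. outcome \<rho> S) = 1"
proof -
  have "(tensor_op (\<lambda>_. mat 1) :: ('c \<Rightarrow> 'q) op) = mat 1"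
    by (auto simp: vec_eq_iff tensor_op_def mat_def fun_eq_iff prod_zero_iff)
  with trace_tensor_spectral_op[of "\<lambda>_ _. 1"] state show ?thesis
    by (simp add: complete quantum_state_def flip: of_real_sum)
qed

lemma pass_prob_eq:
  "pass_prob \<Omega> \<rho> = of_real ((\<Sum>S\<in>UNIV. outcome \<rho> S * (\<Sum>i\<in>UNIV. \<Prod>j\<in>-{i}. c (S j))) / real CARD('c))"
proof -
  have "trace (all_but i \<Omega> ** \<rho>) = of_real (\<Sum>S\<in>UNIV. outcome \<rho> S * (\<Prod>j\<in>-{i}. c (S j)))" for i
  proof -
    \<comment> \<open>The identity on the unsampled copy is also diagonal, with constant eigenvalue
      1, so that copy drops out of the product.\<close>
    have "all_but i \<Omega> = tensor_op (\<lambda>j. spectral_op g (if j = i then \<lambda>_. 1 else c))"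
      unfolding all_but_def by (rule arg_cong[of _ _ tensor_op]) (auto simp: complete \<Omega>)
    moreover have "(\<Prod>j\<in>UNIV. (if j = i then \<lambda>_. 1 else c) (S j)) = (\<Prod>j\<in>-{i}. c (S j))" for S
      by (rule prod.mono_neutral_cong_right) auto
    ultimately show ?thesis
      by (simp add: trace_tensor_spectral_op)
  qed
  then have "pass_prob \<Omega> \<rho> =
      of_real ((\<Sum>i\<in>UNIV. \<Sum>S\<in>UNIV. outcome \<rho> S * (\<Prod>j\<in>-{i}. c (S j))) / real CARD('c))"
    by (simp add: pass_prob_def)
  then show ?thesis
    by (subst (asm) sum.swap) (simp add: sum_distrib_left)
qed

text \<open>Take \<open>X\<close> to be the projector on \<open>g a\<close> in the definition of the
  resultant state: the unsampled copy then contributes the indicator of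
  \<open>S i = a\<close>.\<close>

lemma fidelity_eq:
  assumes "resultant_state \<Omega> \<rho> \<sigma>"
  shows "braket_op (g a) \<sigma> (g a) = of_real (\<Sum>S\<in>UNIV. outcome \<rho> S *
      (\<Sum>i | S i = a. \<Prod>j\<in>-{i}. c (S j))) / (pass_prob \<Omega> \<rho> * of_nat CARD('c))"
proof -
  have "trace (all_but i \<Omega> ** on_site i (ketbra (g a) (g a)) ** \<rho>) =
      of_real (\<Sum>S\<in>UNIV. outcome \<rho> S * (if S i = a then \<Prod>j\<in>-{i}. c (S j) else 0))" for i
  proof -
    have "all_but i \<Omega> ** on_site i (ketbra (g a) (g a)) =
        tensor_op (\<lambda>j. spectral_op g (if j = i then \<lambda>s. of_bool (s = a) else c))"
      unfolding all_but_def on_site_def tensor_op_mult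
      by (rule arg_cong[of _ _ tensor_op]) (auto simp: spectral_op_indicator \<Omega>)
    moreover have "(\<Prod>j\<in>UNIV. (if j = i then \<lambda>s. of_bool (s = a) else c) (S j)) =
        (if S i = a then \<Prod>j\<in>-{i}. c (S j) else 0)" for S
    proof -
      have "(\<Prod>j\<in>UNIV. (if j = i then \<lambda>s. of_bool (s = a) else c) (S j)) =
          of_bool (S i = a) * (\<Prod>j\<in>-{i}. (if j = i then \<lambda>s. of_bool (s = a) else c) (S j))"
        by (subst prod.remove[of _ i]) (auto simp: Compl_eq_Diff_UNIV)
      also have "(\<Prod>j\<in>-{i}. (if j = i then \<lambda>s. of_bool (s = a) else c) (S j)) = (\<Prod>j\<in>-{i}. c (S j))"
        by (rule prod.cong) auto
      finally show ?thesis by simp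
    qed
    ultimately show ?thesis
      by (simp add: trace_tensor_spectral_op)
  qed
  moreover have "braket_op (g a) \<sigma> (g a) = trace (\<sigma> ** ketbra (g a) (g a))"
    by (simp add: trace_mul_sym[of \<sigma>] trace_ketbra_mult)
  ultimately have "braket_op (g a) \<sigma> (g a) = of_real (\<Sum>i\<in>UNIV. \<Sum>S\<in>UNIV. outcome \<rho> S *
      (if S i = a then \<Prod>j\<in>-{i}. c (S j) else 0)) / (pass_prob \<Omega> \<rho> * of_nat CARD('c))"
    using assms by (simp add: resultant_state_def)
  then show ?thesis
    by (subst (asm) sum.swap)
      (simp add: sum.inter_filter[of UNIV, simplified] flip: sum_distrib_left del: of_real_sum)
qed

text \<open>Averaging \<open>sum_prod_all_but_le\<close> over the outcome distribution bounds the
  joint weight of passing with a bad unsampled copy; dividing by the passing probability bounds the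
  infidelity.\<close>

lemma fidelity_ge:
  assumes res: "resultant_state \<Omega> \<rho> \<sigma>"
    and N: "CARD('c) = N + 1" "N \<ge> 1"
    and \<beta>: "0 < \<beta>" "\<beta> \<le> 1" "of_real \<beta> \<le> pass_prob \<Omega> \<rho>"
  shows "of_real (1 - (1 - \<beta>) / (real N * (1 - \<mu>) * \<beta>)) \<le> braket_op (g a) \<sigma> (g a)"
proof -
  define K where "K = real N * (1 - \<mu>)"
  have K: "K > 0" using N \<mu> by (simp add: K_def)
  define w where "w S I = (\<Sum>i\<in>I. \<Prod>j\<in>-{i}. c (S j))" for S :: "'c \<Rightarrow> 'k" and I
  \<comment> \<open>\<open>p\<close> is the passing probability; \<open>f\<close> and
    \<open>b\<close> are its parts in which the unsampled copy is good or bad.\<close>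
  define p where "p = (\<Sum>S\<in>UNIV. outcome \<rho> S * w S UNIV) / (real N + 1)"
  define f where "f = (\<Sum>S\<in>UNIV. outcome \<rho> S * w S {i. S i = a}) / (real N + 1)"
  define b where "b = (\<Sum>S\<in>UNIV. outcome \<rho> S * w S {i. S i \<noteq> a}) / (real N + 1)"
  have p: "pass_prob \<Omega> \<rho> = of_real p"
    using N by (simp add: pass_prob_eq p_def w_def add.commute)
  have fid: "braket_op (g a) \<sigma> (g a) = of_real (f / p)"
    unfolding fidelity_eq[OF res] p using N by (simp add: f_def w_def add.commute)
  have \<beta>p: "\<beta> \<le> p" using \<beta> by (simp add: p less_eq_complex_def)
  with \<beta> have p0: "p > 0" by simp
  have "w S UNIV = w S {i. S i = a} + w S {i. S i \<noteq> a}" for S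
    unfolding w_def by (subst sum.union_disjoint[symmetric]) (auto intro: sum.cong)
  then have pfb: "p = f + b"
    by (simp add: p_def f_def b_def add_divide_distrib sum.distrib distrib_left)
  have "K * w S {i. S i \<noteq> a} + w S UNIV \<le> real N + 1" for S
    unfolding w_def K_def
    using sum_prod_all_but_le[OF N(1), of \<mu> "{i. S i \<noteq> a}" "\<lambda>i. c (S i)"] \<mu> gap ca by simp
  then have "(\<Sum>S\<in>UNIV. outcome \<rho> S * (K * w S {i. S i \<noteq> a} + w S UNIV)) \<le>
      (\<Sum>S\<in>UNIV. outcome \<rho> S * (real N + 1))"
    by (intro sum_mono mult_left_mono outcome_nonneg)
  also have "\<dots> = real N + 1"
    by (simp add: sum_outcome flip: sum_distrib_right)
  also have "(\<Sum>S\<in>UNIV. outcome \<rho> S * (K * w S {i. S i \<noteq> a} + w S UNIV)) = (real N + 1) * (K * b + p)"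
  proof -
    have "real N + 1 \<noteq> 0" by linarith
    then have "(real N + 1) * (K * b + p) =
        K * (\<Sum>S\<in>UNIV. outcome \<rho> S * w S {i. S i \<noteq> a}) + (\<Sum>S\<in>UNIV. outcome \<rho> S * w S UNIV)"
      by (simp add: b_def p_def distrib_left)
    then show ?thesis
      by (simp add: distrib_left sum.distrib sum_distrib_left mult_ac)
  qed
  finally have "K * b + p \<le> 1"
    by (simp add: mult_le_cancel_left2 del: of_nat_Suc)
  then have b: "b / p \<le> (1 - p) / p / K"
    using K p0 by (simp add: field_simps)
  \<comment> \<open>The map from p to (1 - p) / p is decreasing for positive p.\<close>
  also have "(1 - p) / p \<le> (1 - \<beta>) / \<beta>"
    using \<beta> \<beta>p p0 by (simp add: field_simps)
  then have "(1 - p) / p / K \<le> (1 - \<beta>) / \<beta> / K"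
    using K by (intro divide_right_mono) auto
  finally have "b / p \<le> (1 - \<beta>) / (K * \<beta>)" by (simp add: mult.commute)
  moreover have "f / p = 1 - b / p"
    using p0 pfb by (simp add: field_simps)
  ultimately have "1 - (1 - \<beta>) / (K * \<beta>) \<le> f / p" by simp
  then show ?thesis
    unfolding fid K_def less_eq_complex_def by simp
qed

end

text \<open>The outcome distribution is concentrated on the tuple that is constantly
  \<open>a\<close>, where every eigenvalue is 1.\<close>

lemma pass_prob_target:
  fixes v :: "complex^('c::finite \<Rightarrow> 'q)"
  defines "v \<equiv> tensor_vec (\<lambda>_. g a)"
  shows "pass_prob \<Omega> (ketbra v v) = 1"
proof -
  have "(\<Sum>x\<in>UNIV. cnj (v $ x) * v $ x) = 1"
    by (simp add: v_def tensor_vec_inner orth)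
  then have state: "quantum_state (ketbra v v)"
    by (rule quantum_state_ketbra)
  have outcome: "outcome (ketbra v v) S = of_bool (S = (\<lambda>_. a))" for S
  proof -
    have "(\<Sum>x\<in>UNIV. cnj (tensor_vec (\<lambda>t. g (S t)) $ x) * v $ x) = of_bool (S = (\<lambda>_. a))"
      by (auto simp: v_def tensor_vec_inner orth fun_eq_iff prod_zero_iff)
    then show ?thesis
      by (simp add: outcome_def braket_ketbra)
  qed
  show ?thesis
    unfolding pass_prob_eq[OF state] outcome
    by (simp add: of_bool_def if_distribR if_distrib[of "\<lambda>x. x * _"] ca cong: if_cong)
qed

end

subsection \<open>The graph basis\<close>

definition diag_op :: "('i \<Rightarrow> complex) \<Rightarrow> 'i::finite op" where
  "diag_op d = (\<chi> x y. if x = y then d x else 0)"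

lemma diag_op_mult: "diag_op d ** diag_op e = diag_op (\<lambda>x. d x * e x)"
  by (auto simp: vec_eq_iff diag_op_def matrix_matrix_mult_def if_distribR if_distrib[of "\<lambda>x. x * _"]
      cong: if_cong)

lemma diag_op_add: "diag_op d + diag_op e = diag_op (\<lambda>x. d x + e x)"
  by (simp add: vec_eq_iff diag_op_def)

lemma diag_op_one: "diag_op (\<lambda>_. 1) = mat 1"
  by (simp add: vec_eq_iff diag_op_def mat_def)

lemma diag_op_mult_vec: "diag_op d *v v = (\<chi> x. d x * v $ x)"
  by (simp add: vec_eq_iff diag_op_def matrix_vector_mult_def if_distrib[of "\<lambda>x. x * _"] cong: if_cong)

lemma op_prod_diag_op:
  "op_prod (map (\<lambda>p. diag_op (d p)) ps) = diag_op (\<lambda>x. \<Prod>p\<leftarrow>ps. d p x)"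
  by (induction ps) (simp_all add: op_prod_def diag_op_one diag_op_mult)

lemma on_site_diag_op:
  fixes j :: "'t::finite" and d :: "'a::finite \<Rightarrow> complex"
  shows "on_site j (diag_op d) = diag_op (\<lambda>x. d (x j))"
proof -
  have "on_site j (diag_op d) $ x $ y = diag_op (\<lambda>x. d (x j)) $ x $ y" for x y
  proof (cases "x = y")
    case True
    then show ?thesis by (simp add: on_site_nth diag_op_def mat_def)
  next
    case False
    then obtain i where i: "x i \<noteq> y i" by auto
    show ?thesis
    proof (cases "i = j")
      case True
      with i False show ?thesis by (simp add: on_site_nth diag_op_def)
    next
      case neq: False
      have "(\<Prod>t\<in>UNIV - {j}. mat 1 $ x t $ y t :: complex) = 0"
        using i neq by (intro prod_zero) (auto simp: mat_def)
      with False show ?thesis by (simp add: on_site_nth diag_op_def)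
    qed
  qed
  then show ?thesis by (simp add: vec_eq_iff)
qed

lemma ketbra_ket: "ketbra (ket b) (ket b) = diag_op (\<lambda>a. of_bool (a = b))"
  by (auto simp: vec_eq_iff ketbra_def ket_def diag_op_def axis_def)

lemma controlled_phase_eq:
  "controlled_phase j k t = diag_op (\<lambda>x. cis (t * of_bool (x j) * of_bool (x k)))"
proof -
  have "(\<chi> x y. cis t * diag_op (\<lambda>a. of_bool (a = True)) $ x $ y) =
      diag_op (\<lambda>a. cis t * of_bool (a = True))"
    by (simp add: vec_eq_iff diag_op_def)
  then show ?thesis
    unfolding controlled_phase_def ketbra_ket
    by (simp add: diag_op_add on_site_diag_op diag_op_mult) (rule arg_cong[of _ _ diag_op], auto)
qed

definition graph_phase :: "('v \<times> 'v) set \<Rightarrow> ('v \<Rightarrow> 'v \<Rightarrow> real) \<Rightarrow> ('v \<Rightarrow> bool) \<Rightarrow> real" where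
  "graph_phase E \<theta> x = (\<Sum>(j, k)\<in>E. \<theta> j k * of_bool (x j) * of_bool (x k))"

text \<open>The angles 0 and \<open>pi\<close> give |+> and |->, so this is the Hadamard basis
  vector with label \<open>s\<close>, multiplied by the diagonal unitary with phases
  \<open>graph_phase\<close>.\<close>

definition graph_basis ::
  "('v::finite \<times> 'v) set \<Rightarrow> ('v \<Rightarrow> 'v \<Rightarrow> real) \<Rightarrow> ('v \<Rightarrow> bool) \<Rightarrow> complex^('v \<Rightarrow> bool)" where
  "graph_basis E \<theta> s =
     (\<chi> x. cis (graph_phase E \<theta> x) * (\<Prod>j\<in>UNIV. phase_ket (pi * of_bool (s j)) $ x j))"

lemma phase_ket_nth: "phase_ket \<alpha> $ b = cis (\<alpha> * of_bool b) / sqrt 2"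
  by (cases b) (simp_all add: phase_ket_def ket_def axis_def scaleR_conv_of_real[where 'a=complex])

lemma phase_ket_0: "phase_ket 0 = plus_ket"
  by (simp add: phase_ket_def plus_ket_def)

text \<open>Rewrites the comprehension over edges as a map over one distinct list of pairs, so that
  the ordered product can become a product over the set \<open>E\<close>.\<close>

lemma concat_map_if_product:
  "concat (map (\<lambda>j. concat (map (\<lambda>k. if P j k then [f j k] else []) ys)) xs) =
     map (\<lambda>(j, k). f j k) (filter (\<lambda>(j, k). P j k) (List.product xs ys))"
proof (induction xs)
  case (Cons x xs)
  have "concat (map (\<lambda>k. if P x k then [f x k] else []) ys) =
      map (\<lambda>(j, k). f j k) (filter (\<lambda>(j, k). P j k) (map (Pair x) ys))"
    by (induction ys) auto
  with Cons show ?case by simp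
qed simp

lemma prod_cis: "(\<Prod>a\<in>A. cis (f a)) = cis (\<Sum>a\<in>A. f a)"
  by (induction A rule: infinite_finite_induct) (simp_all add: cis_mult)

lemma graph_state_eq: "graph_state E \<theta> = graph_basis E \<theta> (\<lambda>_. False)"
proof -
  define ps where "ps = filter (\<lambda>(j, k). (j, k) \<in> E)
    (List.product (sorted_list_of_set UNIV) (sorted_list_of_set (UNIV :: 'a set)))"
  define d where "d p x = cis (case p of (j, k) \<Rightarrow> \<theta> j k * of_bool (x j) * of_bool (x k))"
    for p and x :: "'a \<Rightarrow> bool"
  have ps: "distinct ps" "set ps = E"
    by (auto simp: ps_def intro!: distinct_filter distinct_product)
  have "op_prod [controlled_phase j k (\<theta> j k).
      j \<leftarrow> sorted_list_of_set UNIV, k \<leftarrow> sorted_list_of_set UNIV, (j, k) \<in> E] =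
      op_prod (map (\<lambda>p. diag_op (d p)) ps)"
    unfolding concat_map_if_product ps_def controlled_phase_eq d_def
    by (intro arg_cong[of _ _ op_prod] map_cong refl) auto
  also have "\<dots> = diag_op (\<lambda>x. \<Prod>p\<in>E. d p x)"
    unfolding op_prod_diag_op ps(2)[symmetric] prod.distinct_set_conv_list[OF ps(1)] ..
  also have "\<dots> = diag_op (\<lambda>x. cis (graph_phase E \<theta> x))"
    by (simp add: d_def prod_cis graph_phase_def)
  finally show ?thesis
    by (simp add: graph_state_def diag_op_mult_vec graph_basis_def tensor_vec_def phase_ket_0)
qed

text \<open>When the eigenvalue factors over the vertices, so does the sum over labels; conjugation
  by the diagonal unitary only adds a phase difference.\<close>

lemma spectral_op_graph_basis_nth:
  "spectral_op (graph_basis E \<theta>) (\<lambda>s. \<Prod>j\<in>UNIV. w j (s j)) $ x $ y =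
     cis (graph_phase E \<theta> x - graph_phase E \<theta> y) *
     (\<Prod>j\<in>UNIV. \<Sum>b\<in>UNIV. of_real (w j b) *
        (phase_ket (pi * of_bool b) $ x j * cnj (phase_ket (pi * of_bool b) $ y j)))"
proof -
  have "cis (graph_phase E \<theta> x - graph_phase E \<theta> y) =
      cis (graph_phase E \<theta> x) * cnj (cis (graph_phase E \<theta> y))"
    by (simp add: cis_cnj cis_mult)
  then show ?thesis
    unfolding spectral_op_nth graph_basis_def
    by (simp add: sum_distrib_left mult_ac prod.distrib flip: sum_prod_fun)
qed

lemma sqrt_2_mult_sqrt_2: "complex_of_real (sqrt 2) * complex_of_real (sqrt 2) = 2"
  by (simp flip: of_real_mult)

lemma hadamard_complete:
  "(\<Sum>b\<in>UNIV. phase_ket (pi * of_bool b) $ a * cnj (phase_ket (pi * of_bool b) $ a')) =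
     of_bool (a = a')"
  by (cases a; cases a') (simp_all add: phase_ket_nth UNIV_bool sqrt_2_mult_sqrt_2)

lemma hadamard_orthonormal:
  "(\<Sum>a\<in>UNIV. cnj (phase_ket (pi * of_bool b) $ a) * phase_ket (pi * of_bool b') $ a) =
     of_bool (b = b')"
  by (cases b; cases b') (simp_all add: phase_ket_nth UNIV_bool sqrt_2_mult_sqrt_2)

lemma prod_of_bool: "finite A \<Longrightarrow> (\<Prod>a\<in>A. of_bool (P a) :: 'b::comm_semiring_1) = of_bool (\<forall>a\<in>A. P a)"
  by (induction A rule: finite_induct) auto

lemma prod_remove_of_bool:
  fixes k :: "'v::finite"
  assumes "\<And>j. j \<noteq> k \<Longrightarrow> f j = of_bool (P j)"
  shows "(\<Prod>j\<in>UNIV. f j :: complex) = f k * of_bool (\<forall>j. j \<noteq> k \<longrightarrow> P j)"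
proof -
  have "(\<Prod>j\<in>UNIV. f j) = f k * (\<Prod>j\<in>UNIV - {k}. f j)"
    by (rule prod.remove) auto
  also have "(\<Prod>j\<in>UNIV - {k}. f j) = (\<Prod>j\<in>UNIV - {k}. of_bool (P j))"
    using assms by (intro prod.cong) auto
  also have "\<dots> = of_bool (\<forall>j. j \<noteq> k \<longrightarrow> P j)"
    by (subst prod_of_bool) auto
  finally show ?thesis .
qed

lemma graph_basis_complete: "spectral_op (graph_basis E \<theta>) (\<lambda>_. 1) = mat 1"
proof -
  have "spectral_op (graph_basis E \<theta>) (\<lambda>_. 1) $ x $ y = mat 1 $ x $ y" for x y
    using spectral_op_graph_basis_nth[of E \<theta> "\<lambda>_ _. 1" x y]
    by (auto simp: hadamard_complete prod_of_bool mat_def)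
  then show ?thesis by (simp add: vec_eq_iff)
qed

lemma graph_basis_orthonormal:
  "(\<Sum>x\<in>UNIV. cnj (graph_basis E \<theta> s $ x) * graph_basis E \<theta> t $ x) = of_bool (s = t)"
proof -
  have "cnj (graph_basis E \<theta> s $ x) * graph_basis E \<theta> t $ x =
      (\<Prod>j\<in>UNIV. cnj (phase_ket (pi * of_bool (s j)) $ x j) * phase_ket (pi * of_bool (t j)) $ x j)"
    for x
  proof -
    have "cnj (cis (graph_phase E \<theta> x)) * cis (graph_phase E \<theta> x) = 1"
      by (simp add: cis_cnj cis_mult)
    then have "cnj (cis (graph_phase E \<theta> x) * p) * (cis (graph_phase E \<theta> x) * q) = cnj p * q" for p q
      by (metis (no_types) complex_cnj_mult mult.assoc mult.left_commute mult_1)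
    then show ?thesis
      by (simp only: graph_basis_def vec_lambda_beta) (simp add: prod.distrib)
  qed
  then show ?thesis
    using sum_prod_fun[of "\<lambda>j a. cnj (phase_ket (pi * of_bool (s j)) $ a) *
      phase_ket (pi * of_bool (t j)) $ a"]
    by (simp only: hadamard_orthonormal) (simp add: prod_of_bool fun_eq_iff)
qed

text \<open>Only edges at \<open>k\<close> change their term, and each changes it by its weight
  times the bit of the other endpoint. This identifies the angle in \<open>test_Q\<close>.\<close>

lemma graph_phase_diff:
  fixes E :: "('v::{finite,linorder} \<times> 'v) set"
  assumes graph: "weighted_graph E \<theta>" and eq: "\<And>j. j \<noteq> k \<Longrightarrow> x j = y j"
  shows "graph_phase E \<theta> x - graph_phase E \<theta> y =
    phase_angle E \<theta> k x * (of_bool (x k) - of_bool (y k))"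
proof -
  define D where "D = (of_bool (x k) - of_bool (y k) :: real)"
  define h where "h j = \<theta> j k * of_bool (x j)" for j
  have less: "i < j" if "(i, j) \<in> E" for i j
    using graph that by (auto simp: weighted_graph_def)
  have sym: "\<theta> i j = \<theta> j i" for i j
    using graph by (simp add: weighted_graph_def)
  have "graph_phase E \<theta> x - graph_phase E \<theta> y =
      (\<Sum>(i, j)\<in>E. \<theta> i j * of_bool (x i) * of_bool (x j) - \<theta> i j * of_bool (y i) * of_bool (y j))"
    by (simp add: graph_phase_def case_prod_unfold sum_subtractf)
  \<comment> \<open>The ends of an edge differ, so at most one of the two summands is
    nonzero.\<close>
  also have "\<dots> = (\<Sum>p\<in>E. (if fst p = k then h (snd p) * D else 0) + (if snd p = k then h (fst p) * D else 0))"
  proof (rule sum.cong[OF refl], clarify)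
    fix i j assume "(i, j) \<in> E"
    then have "i \<noteq> j" using less by blast
    then show "\<theta> i j * of_bool (x i) * of_bool (x j) - \<theta> i j * of_bool (y i) * of_bool (y j) =
      (if fst (i, j) = k then h (snd (i, j)) * D else 0) + (if snd (i, j) = k then h (fst (i, j)) * D else 0)"
      using eq[of i] eq[of j] sym[of i j] by (auto simp: h_def D_def algebra_simps)
  qed
  also have "\<dots> = (\<Sum>j | (k, j) \<in> E. h j * D) + (\<Sum>j | (j, k) \<in> E. h j * D)"
  proof -
    have "(\<Sum>p\<in>E. if fst p = k then h (snd p) * D else 0) = (\<Sum>p\<in>{p\<in>E. fst p = k}. h (snd p) * D)"
      by (rule sum.inter_filter[symmetric]) simp
    also have "\<dots> = (\<Sum>j | (k, j) \<in> E. h j * D)"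
      by (rule sum.reindex_bij_witness[of _ "Pair k" snd]) auto
    finally have 1: "(\<Sum>p\<in>E. if fst p = k then h (snd p) * D else 0) = (\<Sum>j | (k, j) \<in> E. h j * D)" .
    have "(\<Sum>p\<in>E. if snd p = k then h (fst p) * D else 0) = (\<Sum>p\<in>{p\<in>E. snd p = k}. h (fst p) * D)"
      by (rule sum.inter_filter[symmetric]) simp
    also have "\<dots> = (\<Sum>j | (j, k) \<in> E. h j * D)"
      by (rule sum.reindex_bij_witness[of _ "\<lambda>j. (j, k)" fst]) auto
    finally show ?thesis using 1 by (simp add: sum.distrib)
  qed
  also have "\<dots> = (\<Sum>j\<in>{j. (k, j) \<in> E} \<union> {j. (j, k) \<in> E}. h j * D)"
    \<comment> \<open>Edges are stored in increasing order, so no neighbour is counted in both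
      orientations.\<close>
    by (intro sum.union_disjoint[symmetric]) (auto dest!: less)
  also have "{j. (k, j) \<in> E} \<union> {j. (j, k) \<in> E} = {j. adjacent E j k}"
    by (auto simp: adjacent_def)
  finally show ?thesis
    unfolding phase_angle_def sum_distrib_right h_def D_def .
qed

subsection \<open>Spectral decomposition of the test operator\<close>

text \<open>Every vertex outside \<open>A\<close> is projected on its bit of \<open>z\<close>, so
  only the \<open>z\<close> that agrees with \<open>x\<close> there contributes.\<close>

lemma test_Q_nth:
  assumes indep: "independent_set E A" and k: "k \<in> A"
  shows "test_Q E \<theta> A k $ x $ y = of_bool (\<forall>j. j \<noteq> k \<longrightarrow> x j = y j) *
    cis (phase_angle E \<theta> k x * (of_bool (x k) - of_bool (y k))) / 2"
proof -
  define F where "F z = ketbra (phase_ket (phase_angle E \<theta> k z)) (phase_ket (phase_angle E \<theta> k z))" for z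
  have term_eq: "(on_site k (F z) ** basis_projector (- A) z) $ x $ y =
      (if z = restrict x (- A) then F z $ x k $ y k * of_bool (\<forall>j. j \<noteq> k \<longrightarrow> x j = y j) else 0)"
    if z: "z \<in> PiE (- A) (\<lambda>_. UNIV)" for z
  proof -
    define M where "M j = (if j = k then F z else mat 1) **
      (if j \<in> - A then ketbra (ket (z j)) (ket (z j)) else mat 1)" for j
    have M: "M j = (if j \<in> A then mat 1 else diag_op (\<lambda>a. of_bool (a = z j)))" if "j \<noteq> k" for j
      using that by (simp add: M_def ketbra_ket)
    have "(\<Prod>j\<in>UNIV. M j $ x j $ y j) =
        M k $ x k $ y k * of_bool (\<forall>j. j \<noteq> k \<longrightarrow> x j = y j \<and> (j \<in> - A \<longrightarrow> z j = x j))"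
      by (rule prod_remove_of_bool)
        (auto simp: M diag_op_def mat_def)
    moreover have "M k = F z" using k by (simp add: M_def)
    moreover have "(\<forall>j. j \<noteq> k \<longrightarrow> x j = y j \<and> (j \<in> - A \<longrightarrow> z j = x j)) \<longleftrightarrow>
        (\<forall>j. j \<noteq> k \<longrightarrow> x j = y j) \<and> z = restrict x (- A)"
      using z k by (auto simp: fun_eq_iff restrict_def PiE_def extensional_def)
    moreover have "on_site k (F z) ** basis_projector (- A) z = tensor_op M"
      unfolding on_site_def basis_projector_def tensor_op_mult M_def ..
    ultimately show ?thesis
      by (simp add: tensor_op_def del: prod_zero_iff)
  qed
  have "test_Q E \<theta> A k $ x $ y =
      F (restrict x (- A)) $ x k $ y k * of_bool (\<forall>j. j \<noteq> k \<longrightarrow> x j = y j)"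
    unfolding test_Q_def F_def[symmetric] sum_component
    by (simp add: term_eq cong: sum.cong)
  \<comment> \<open>\<open>restrict\<close> puts \<open>undefined\<close> on \<open>A\<close>, but
    by independence all neighbours of \<open>k\<close> lie outside \<open>A\<close>, so that value
    is never read.\<close>
  moreover have "phase_angle E \<theta> k (restrict x (- A)) = phase_angle E \<theta> k x"
    unfolding phase_angle_def
    using indep k by (intro sum.cong) (auto simp: independent_set_def)
  moreover have "cis t * cnj (cis u) = cis (t - u)" for t u
    by (simp add: cis_cnj cis_mult)
  ultimately show ?thesis
    by (simp add: F_def ketbra_def phase_ket_nth sqrt_2_mult_sqrt_2 right_diff_distrib)
qed

text \<open>Entrywise comparison: both sides vanish unless \<open>x\<close> and \<open>y\<close>
  agree off \<open>k\<close>; there both have modulus 1/2, and \<open>graph_phase_diff\<close>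
  matches the phases.\<close>

lemma test_Q_eq:
  assumes "weighted_graph E \<theta>" "independent_set E A" "k \<in> A"
  shows "test_Q E \<theta> A k = spectral_op (graph_basis E \<theta>) (\<lambda>s. of_bool (\<not> s k))"
proof -
  have "test_Q E \<theta> A k $ x $ y = spectral_op (graph_basis E \<theta>) (\<lambda>s. of_bool (\<not> s k)) $ x $ y" for x y
  proof -
    define w where "w j b = (of_bool (j = k \<longrightarrow> \<not> b) :: real)" for j b
    define h where "h j = (\<Sum>b\<in>UNIV. of_real (w j b) *
        (phase_ket (pi * of_bool b) $ x j * cnj (phase_ket (pi * of_bool b) $ y j)))" for j
    \<comment> \<open>The eigenvalue is a product over vertices with factor 1 away from
      \<open>k\<close>, as \<open>spectral_op_graph_basis_nth\<close> requires.\<close>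
    have w: "(\<lambda>s. of_bool (\<not> s k)) = (\<lambda>s. \<Prod>j\<in>UNIV. w j (s j))"
      by (auto simp: w_def fun_eq_iff prod_of_bool)
    have "h j = of_bool (x j = y j)" if "j \<noteq> k" for j
      using that by (simp add: h_def w_def hadamard_complete)
    then have "(\<Prod>j\<in>UNIV. h j) = h k * of_bool (\<forall>j. j \<noteq> k \<longrightarrow> x j = y j)"
      by (rule prod_remove_of_bool)
    moreover have "h k = 1 / 2"
      by (simp add: h_def w_def UNIV_bool phase_ket_nth sqrt_2_mult_sqrt_2)
    ultimately show ?thesis
      using graph_phase_diff[OF assms(1), of k x y]
      unfolding w spectral_op_graph_basis_nth h_def[symmetric] test_Q_nth[OF assms(2,3)]
      by (cases "\<forall>j. j \<noteq> k \<longrightarrow> x j = y j") (simp_all del: prod_zero_iff)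
  qed
  then show ?thesis by (simp add: vec_eq_iff)
qed

text \<open>The factors share an orthonormal eigenbasis, so their 0/1 eigenvalues multiply to a
  conjunction; the induction covers every list drawn from \<open>A\<close>.\<close>

lemma test_P_eq:
  assumes "weighted_graph E \<theta>" "independent_set E A"
  shows "test_P E \<theta> A = spectral_op (graph_basis E \<theta>) (\<lambda>s. of_bool (\<forall>k\<in>A. \<not> s k))"
proof -
  have "op_prod (map (test_Q E \<theta> A) ks) =
      spectral_op (graph_basis E \<theta>) (\<lambda>s. of_bool (\<forall>k\<in>set ks. \<not> s k))" if "set ks \<subseteq> A" for ks
    using that
  proof (induction ks)
    case (Cons k ks)
    then show ?case
      using test_Q_eq[OF assms, of k]
      by (simp add: op_prod_def spectral_op_mult graph_basis_orthonormal flip: of_bool_conj)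
  qed (simp add: op_prod_def graph_basis_complete)
  then show ?thesis by (simp add: test_P_def)
qed

definition pass_weight :: "'v set set \<Rightarrow> ('v \<Rightarrow> bool) \<Rightarrow> real" where
  "pass_weight \<A> s = (1 / real (card \<A>)) * (\<Sum>A\<in>\<A>. of_bool (\<forall>k\<in>A. \<not> s k))"

lemma test_operator_eq:
  assumes "weighted_graph E \<theta>" "independence_cover E \<A>"
  shows "test_operator E \<theta> \<A> = spectral_op (graph_basis E \<theta>) (pass_weight \<A>)"
  using assms
  by (simp add: test_operator_def independence_cover_def test_P_eq spectral_op_sum
      spectral_op_scaleR pass_weight_def[abs_def] cong: sum.cong)

text \<open>A nonzero label has a set bit at some \<open>k\<close>, and the member of the cover
  containing \<open>k\<close> then contributes 0 to the average.\<close>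

lemma pass_weight_bounds:
  fixes \<A> :: "'v::finite set set"
  assumes cover: "\<Union>\<A> = UNIV" and s: "s \<noteq> (\<lambda>_. False)"
  shows "0 \<le> pass_weight \<A> s" "pass_weight \<A> s \<le> 1 - 1 / real (card \<A>)"
proof -
  show "0 \<le> pass_weight \<A> s"
    by (simp add: pass_weight_def sum_nonneg)
  obtain k where k: "s k" using s by auto
  have "k \<in> \<Union>\<A>" by (simp add: cover)
  then obtain A where A: "A \<in> \<A>" "k \<in> A" by (rule UnionE)
  have m: "card \<A> \<ge> 1"
    using A(1) by (auto simp: Suc_le_eq card_gt_0_iff)
  have "(\<Sum>A\<in>\<A>. of_bool (\<forall>k\<in>A. \<not> s k) :: real) = (\<Sum>B\<in>\<A> - {A}. of_bool (\<forall>k\<in>B. \<not> s k))"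
    using A k by (subst sum.remove[of _ A]) auto
  also have "\<dots> \<le> (\<Sum>B\<in>\<A> - {A}. 1)"
    by (intro sum_mono) simp
  also have "\<dots> = real (card \<A>) - 1"
    using A m by (simp add: card_Diff_singleton of_nat_diff)
  finally have "pass_weight \<A> s \<le> (1 / real (card \<A>)) * (real (card \<A>) - 1)"
    unfolding pass_weight_def by (intro mult_left_mono) auto
  also have "\<dots> = 1 - 1 / real (card \<A>)"
    using A(1) by (auto simp: right_diff_distrib)
  finally show "pass_weight \<A> s \<le> 1 - 1 / real (card \<A>)" .
qed

theorem theorem1:
  fixes E :: "('v::{finite,linorder} \<times> 'v) set"
    and \<theta> :: "'v \<Rightarrow> 'v \<Rightarrow> real"
    and \<A> :: "'v set set"
    and N :: nat
    and \<beta> :: real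
  assumes "weighted_graph E \<theta>"
    and "independence_cover E \<A>"
    and "N \<ge> 1"
    and "CARD('c::finite) = N + 1"
    and "0 < \<beta>" and "\<beta> \<le> 1"
  shows "pass_prob (test_operator E \<theta> \<A>)
           (ketbra (tensor_vec (\<lambda>_::'c. graph_state E \<theta>))
                   (tensor_vec (\<lambda>_::'c. graph_state E \<theta>))) = 1 \<and>
         (\<forall>\<rho> :: ('c \<Rightarrow> 'v \<Rightarrow> bool) op. \<forall>\<sigma>.
            quantum_state \<rho> \<longrightarrow>
            complex_of_real \<beta> \<le> pass_prob (test_operator E \<theta> \<A>) \<rho> \<longrightarrow>
            resultant_state (test_operator E \<theta> \<A>) \<rho> \<sigma> \<longrightarrow>
            complex_of_real (1 - real (card \<A>) * (1 - \<beta>) / (real N * \<beta>))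
              \<le> braket_op (graph_state E \<theta>) \<sigma> (graph_state E \<theta>))"
proof -
  have cover: "\<Union>\<A> = UNIV"
    using assms(2) by (auto simp: independence_cover_def partition_on_def)
  then have nonempty: "\<A> \<noteq> {}" by auto
  then have m: "card \<A> \<ge> 1" by (simp add: Suc_leI card_gt_0_iff)
  \<comment> \<open>Here 1 - \<mu> is the reciprocal of \<open>card \<A>\<close>, which puts the
    factor \<open>card \<A>\<close> into the final bound.\<close>
  interpret spectral_test "graph_basis E \<theta>" "test_operator E \<theta> \<A>" "pass_weight \<A>" "\<lambda>_. False"
      "1 - 1 / real (card \<A>)"
  proof
    show "pass_weight \<A> (\<lambda>_. False) = 1"
      using nonempty by (simp add: pass_weight_def)
  qed (use m in \<open>simp_all add: graph_basis_complete graph_basis_orthonormal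
      test_operator_eq[OF assms(1,2)] pass_weight_bounds[OF cover]\<close>)
  show ?thesis
    unfolding graph_state_eq
    using pass_prob_target fidelity_ge[OF _ _ assms(4,3,5,6)] m by (auto simp: mult_ac)
qed

end
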